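(* Let $W_{ij}=W_{ji}\ge 0$ ($i\neq j$, $i,j\in\{1,\dots,n\}$) be weights and let $x=(x_1,\dots,x_n)$ with all $x_i$ on the unit circle in $\mathbb{R}^2$, such that $x_i\neq x_j$ and $x_i\neq -x_j$ whenever $W_{ij}\neq 0$. For each pair with $W_{ij}\neq 0$ let $\alpha_{ij}\in\mathbb{R}$ be the directed angle defined by $$\alpha_{ij}\Omega=\operatorname{log}\left(\begin{bmatrix}x_i\cdot x_j & x_i\cdot\Omega x_j\\ x_j\cdot\Omega x_i & x_i\cdot x_j\end{bmatrix}\right),\qquad \Omega=\begin{bmatrix}0&1\\-1&0\end{bmatrix}.$$ Denote by $\alpha$ the vector whose entries are $1/\alpha_{ij}$ for the pairs $(i,j)$ with $j>i$ and $W_{ij}\neq 0$, in lexicographic order, and by $E$ the weighted incidence matrix whose columns are the nonzero vectors $W_{ij}(e_i-e_j)\in\mathbb{R}^n$, $j>i$, in the same order. Then $x$ is an equilibrium of the system of differential equations $$\dot{x}_i=\left(\frac{1-\|x_i\|}{\|x_i\|}\right)x_i+\sum_{j=1}^{n}\frac{W_{ij}}{\|x_i\|}\left(\operatorname{log}\left(\frac{1}{\|x_i\|\|x_j\|}\begin{bmatrix}x_i\cdot x_j & x_i\cdot\Omega x_j\\ x_j\cdot\Omega x_i & x_i\cdot x_j\end{bmatrix}\right)\right)^{-1}x_i,\quad i=1,\dots,n,$$ if and only if $\alpha$ is in the nullspace of $E$, i.e., $E\alpha=0$.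
   Context: $e_i$ is the $i$th standard basis vector of $\mathbb{R}^n$. $\operatorname{log}:\operatorname{SO}(2)\to\mathfrak{so}(2)$ is the logarithmic map (principal logarithm, so $\alpha_{ij}\in(-\pi,\pi)\setminus\{0\}$ for the pairs considered), and the inverse of its value is the matrix inverse. $W_{ii}=0$, and in the sum only the terms with $W_{ij}\neq 0$ occur. The undirected weighted graph associated with $(i,j)\mapsto W_{ij}$ has vertices $1,\dots,n$, with $i$ and $j$ neighbors iff $W_{ij}>0$, the edge then having weight $W_{ij}$; $E$ is its weighted (oriented) incidence matrix. An equilibrium is a point at which the right-hand side vanishes for all $i$. *)

theory Defs
  imports
    "Jordan_Normal_Form.Matrix_Kernel"
    "HOL-Analysis.Analysis"
begin

text \<open>
  Points of the plane and $2\times 2$ matrices are \<^typ>\<open>real^2\<close> and \<^typ>\<open>real^2^2\<close>.  The incidence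
  matrix, whose number of columns depends on the weights, is a carrier-based matrix.  The infix
  symbols \<open>$\<close> and \<open>\<bullet>\<close>, common to both libraries, refer to the type-indexed vectors.
\<close>

no_notation vec_index (infixl \<open>$\<close> 100)
no_notation scalar_prod (infix \<open>\<bullet>\<close> 70)
unbundle inner_syntax

definition Omega :: "real^2^2"  (\<open>\<Omega>\<close>)
  where "\<Omega> = vector [vector [0, 1], vector [-1, 0]]"

definition matrix_exp :: "real^'n^'n \<Rightarrow> real^'n^'n"
  where "matrix_exp A =
    (\<Sum>k. (1 / fact k) *\<^sub>R ((\<lambda>B. A ** B) ^^ k) (Finite_Cartesian_Product.mat 1))"

text \<open>
  A skew-symmetric \<open>A\<close> has eigenvalues \<open>\<plusminus> \<i> A\<^sub>1\<^sub>2\<close>, so the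
  bounds on \<open>A\<^sub>1\<^sub>2\<close> select the principal branch.  The upper bound is attained only at
  \<open>- mat 1\<close>, which makes the map total on $SO(2)$.
\<close>
definition log_SO2 :: "real^2^2 \<Rightarrow> real^2^2"
  where "log_SO2 R =
    (THE A. Finite_Cartesian_Product.transpose A = - A \<and> - pi < A $ 1 $ 2 \<and> A $ 1 $ 2 \<le> pi
       \<and> matrix_exp A = R)"

definition relative_matrix :: "real^2 \<Rightarrow> real^2 \<Rightarrow> real^2^2"
  where "relative_matrix u v =
    vector [vector [u \<bullet> v, u \<bullet> (\<Omega> *v v)],
            vector [v \<bullet> (\<Omega> *v u), u \<bullet> v]]"

text \<open>
  The vertices are \<open>0, \<dots>, n - 1\<close>, and only the values of \<open>W\<close> and \<open>x\<close> at such indices are used.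
\<close>
definition vector_field ::
    "nat \<Rightarrow> (nat \<Rightarrow> nat \<Rightarrow> real) \<Rightarrow> (nat \<Rightarrow> real^2) \<Rightarrow> nat \<Rightarrow> real^2"
  where "vector_field n W x i =
    ((1 - norm (x i)) / norm (x i)) *\<^sub>R x i
    + (\<Sum>j\<in>{j. j < n \<and> W i j \<noteq> 0}. (W i j / norm (x i)) *\<^sub>R
        (matrix_inv (log_SO2 ((1 / (norm (x i) * norm (x j))) *\<^sub>R relative_matrix (x i) (x j)))
          *v x i))"

definition equilibrium ::
    "nat \<Rightarrow> ((nat \<Rightarrow> real^2) \<Rightarrow> nat \<Rightarrow> real^2) \<Rightarrow> (nat \<Rightarrow> real^2) \<Rightarrow> bool"
  where "equilibrium n F x \<longleftrightarrow> (\<forall>i<n. F x i = 0)"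

text \<open>The list comprehension enumerates the edges in lexicographic order.\<close>
definition edges :: "nat \<Rightarrow> (nat \<Rightarrow> nat \<Rightarrow> real) \<Rightarrow> (nat \<times> nat) list"
  where "edges n W = [(i, j). i \<leftarrow> [0..<n], j \<leftarrow> [Suc i..<n], W i j \<noteq> 0]"

definition incidence_matrix :: "nat \<Rightarrow> (nat \<Rightarrow> nat \<Rightarrow> real) \<Rightarrow> real Matrix.mat"
  where "incidence_matrix n W =
    mat_of_cols n (map (\<lambda>(i, j). W i j \<cdot>\<^sub>v (unit_vec n i - unit_vec n j)) (edges n W))"

definition inverse_angle_vec ::
    "nat \<Rightarrow> (nat \<Rightarrow> nat \<Rightarrow> real) \<Rightarrow> (nat \<Rightarrow> nat \<Rightarrow> real) \<Rightarrow> real Matrix.vec"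
  where "inverse_angle_vec n W \<alpha> = vec_of_list (map (\<lambda>(i, j). 1 / \<alpha> i j) (edges n W))"

end

theory Submission
  imports Defs
begin

text \<open>
  Scalings of rotations form a copy of the complex numbers in the \<open>2 \<times> 2\<close> matrices.  It turns the
  logarithm on $SO(2)$ into \<open>Arg\<close> and shows that \<open>\<alpha>\<close> is antisymmetric and nonzero on edges.  As
  \<open>(\<alpha> \<Omega>)\<^sup>-\<^sup>1 = - (1 / \<alpha>) \<Omega>\<close>, the field at unit vectors is \<open>- (\<Sum>j. W i j / \<alpha> i j) \<Omega> (x i)\<close>, and
  by antisymmetry that coefficient sum is the \<open>i\<close>-th entry of \<open>E \<alpha>\<close>.
\<close>

text \<open>The imaginary unit goes to \<open>\<Omega>\<close>, a clockwise quarter turn, so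
  \<open>complex_mat z\<close> acts on the plane as multiplication by the conjugate of
  \<open>z\<close>.\<close>

definition complex_mat :: "complex \<Rightarrow> real^2^2"
  where "complex_mat z = Re z *\<^sub>R Finite_Cartesian_Product.mat 1 + Im z *\<^sub>R \<Omega>"

lemma complex_mat_nth:
  "complex_mat z $ 1 $ 1 = Re z" "complex_mat z $ 1 $ 2 = Im z"
  "complex_mat z $ 2 $ 1 = - Im z" "complex_mat z $ 2 $ 2 = Re z"
  by (simp_all add: complex_mat_def Omega_def Finite_Cartesian_Product.mat_def)

lemma matrix2_eq_iff:
  "(A :: 'a^2^2) = B \<longleftrightarrow>
    A $ 1 $ 1 = B $ 1 $ 1 \<and> A $ 1 $ 2 = B $ 1 $ 2 \<and>
    A $ 2 $ 1 = B $ 2 $ 1 \<and> A $ 2 $ 2 = B $ 2 $ 2"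
  by (auto simp: Finite_Cartesian_Product.vec_eq_iff forall_2)

lemma complex_mat_inject: "complex_mat z = complex_mat w \<longleftrightarrow> z = w"
  by (auto simp: matrix2_eq_iff complex_mat_nth complex_eq_iff)

lemma complex_mat_1: "complex_mat 1 = Finite_Cartesian_Product.mat 1"
  by (simp add: complex_mat_def)

lemma complex_mat_mult: "complex_mat (z * w) = complex_mat z ** complex_mat w"
  by (simp add: matrix2_eq_iff complex_mat_nth matrix_matrix_mult_def sum_2)

lemma bounded_linear_complex_mat: "bounded_linear complex_mat"
  unfolding complex_mat_def
  by (intro bounded_linear_add bounded_linear_scaleR_const bounded_linear_Re bounded_linear_Im)

lemma scaleR_Omega: "a *\<^sub>R \<Omega> = complex_mat (\<i> * of_real a)"
  by (simp add: complex_mat_def)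

text \<open>Being multiplicative and bounded linear, \<open>complex_mat\<close> carries the power
  series of \<open>exp\<close> term by term to the matrix series.\<close>

lemma matrix_exp_complex_mat: "matrix_exp (complex_mat z) = complex_mat (exp z)"
proof -
  have pow: "((\<lambda>B. complex_mat z ** B) ^^ k) (Finite_Cartesian_Product.mat 1) = complex_mat (z ^ k)"
    for k
    by (induction k) (simp_all add: complex_mat_1 complex_mat_mult)
  have "(\<lambda>k. complex_mat (z ^ k /\<^sub>R fact k)) sums complex_mat (exp z)"
    by (rule bounded_linear.sums[OF bounded_linear_complex_mat exp_converges])
  then have "(\<lambda>k. (1 / fact k) *\<^sub>R complex_mat (z ^ k)) sums complex_mat (exp z)"
    by (simp add: linear_scale[OF bounded_linear.linear[OF bounded_linear_complex_mat]] inverse_eq_divide)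
  then show ?thesis
    unfolding matrix_exp_def pow by (rule sums_unique[symmetric])
qed

lemma skew_2_eq_scaleR_Omega:
  assumes "Finite_Cartesian_Product.transpose A = - (A :: real^2^2)"
  shows "A = (A $ 1 $ 2) *\<^sub>R \<Omega>"
proof -
  have "A $ j $ i = - A $ i $ j" for i j
    using arg_cong[OF assms, of "\<lambda>B. B $ i $ j"] by (simp add: Finite_Cartesian_Product.transpose_def)
  from this[of 1 1] this[of 2 2] this[of 2 1] show ?thesis
    by (simp add: matrix2_eq_iff Omega_def)
qed

text \<open>A skew candidate is some \<open>a *\<^sub>R \<Omega>\<close>, whose exponential is the
  image of exp (\<i> a). The condition on it thus says that \<open>a\<close> is an angle of
  \<open>z\<close> in (- pi, pi], and \<open>Arg z\<close> is the only one.\<close>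

lemma log_SO2_complex_mat:
  assumes "norm z = 1"
  shows "log_SO2 (complex_mat z) = Arg z *\<^sub>R \<Omega>"
  unfolding log_SO2_def
proof (rule the_equality)
  have "z \<noteq> 0"
    using assms by auto
  then have "exp (\<i> * of_real (Arg z)) = z"
    using Arg_eq[of z] assms by simp
  then show "Finite_Cartesian_Product.transpose (Arg z *\<^sub>R \<Omega>) = - (Arg z *\<^sub>R \<Omega>)
      \<and> - pi < (Arg z *\<^sub>R \<Omega>) $ 1 $ 2 \<and> (Arg z *\<^sub>R \<Omega>) $ 1 $ 2 \<le> pi
      \<and> matrix_exp (Arg z *\<^sub>R \<Omega>) = complex_mat z"
    using Arg_bounded[of z]
    by (auto simp: scaleR_Omega matrix_exp_complex_mat matrix2_eq_iff complex_mat_nth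
        Finite_Cartesian_Product.transpose_def)
next
  fix A :: "real^2^2"
  assume A: "Finite_Cartesian_Product.transpose A = - A \<and> - pi < A $ 1 $ 2 \<and> A $ 1 $ 2 \<le> pi
    \<and> matrix_exp A = complex_mat z"
  then have skew: "A = (A $ 1 $ 2) *\<^sub>R \<Omega>"
    using skew_2_eq_scaleR_Omega by blast
  then have "complex_mat (exp (\<i> * of_real (A $ 1 $ 2))) = complex_mat z"
    using A by (metis matrix_exp_complex_mat scaleR_Omega)
  then have "z = exp (\<i> * of_real (A $ 1 $ 2))"
    by (simp add: complex_mat_inject)
  then have "Arg z = A $ 1 $ 2"
    using A Arg_unique[of 1 "A $ 1 $ 2" z] by simp
  with skew show "A = Arg z *\<^sub>R \<Omega>"
    by simp
qed

text \<open>\<open>matrix_inv\<close> chooses some two-sided inverse, so exhibiting one determines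
  its value.\<close>

lemma matrix_inv_unique:
  fixes A :: "'a::semiring_1^'n^'m"
  assumes "A ** B = Finite_Cartesian_Product.mat 1" "B ** A = Finite_Cartesian_Product.mat 1"
  shows "matrix_inv A = B"
  unfolding matrix_inv_def
proof (rule some_equality)
  fix C
  assume "A ** C = Finite_Cartesian_Product.mat 1 \<and> C ** A = Finite_Cartesian_Product.mat 1"
  then show "C = B"
    using assms by (metis matrix_mul_assoc matrix_mul_lid matrix_mul_rid)
qed (use assms in simp)

lemma matrix_inv_scaleR_Omega:
  assumes "a \<noteq> 0"
  shows "matrix_inv (a *\<^sub>R \<Omega>) = (- 1 / a) *\<^sub>R \<Omega>"
proof (rule matrix_inv_unique)
  show "(a *\<^sub>R \<Omega>) ** ((- 1 / a) *\<^sub>R \<Omega>) = Finite_Cartesian_Product.mat 1"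
    and "((- 1 / a) *\<^sub>R \<Omega>) ** (a *\<^sub>R \<Omega>) = Finite_Cartesian_Product.mat 1"
    using assms
    by (simp_all add: scaleR_Omega flip: complex_mat_mult complex_mat_1)
qed

lemma Omega_mult_eq_0_iff: "\<Omega> *v u = 0 \<longleftrightarrow> u = 0"
  by (auto simp: Finite_Cartesian_Product.vec_eq_iff forall_2 Omega_def
      matrix_vector_mult_def sum_2)

text \<open>With the plane read as the complex numbers this is the product of \<open>v\<close> and
  the conjugate of \<open>u\<close>; for nonzero vectors its argument is the signed angle from
  \<open>u\<close> to \<open>v\<close>.\<close>

definition relative_complex :: "real^2 \<Rightarrow> real^2 \<Rightarrow> complex"
  where "relative_complex u v = Complex (u \<bullet> v) (u \<bullet> (\<Omega> *v v))"

lemma relative_matrix_eq: "relative_matrix u v = complex_mat (relative_complex u v)"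
  by (simp add: relative_matrix_def relative_complex_def matrix2_eq_iff complex_mat_nth
      inner_vec_def sum_2 Omega_def matrix_vector_mult_def)

lemma relative_complex_commute: "relative_complex v u = cnj (relative_complex u v)"
  by (simp add: relative_complex_def complex_eq_iff inner_vec_def sum_2 Omega_def
      matrix_vector_mult_def)

text \<open>After squaring, this is Lagrange's identity in the plane.\<close>

lemma norm_relative_complex: "norm (relative_complex u v) = norm u * norm v"
proof -
  have "(norm (relative_complex u v))\<^sup>2 = (norm u * norm v)\<^sup>2"
    by (simp add: cmod_power2 relative_complex_def power_mult_distrib power2_norm_eq_inner
        inner_vec_def sum_2 Omega_def matrix_vector_mult_def)
      (simp add: algebra_simps power2_eq_square)
  then show ?thesis
    by (simp add: power2_eq_iff_nonneg)
qed

lemma log_SO2_relative_matrix: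
  assumes "norm u = 1" "norm v = 1"
  shows "log_SO2 (relative_matrix u v) = Arg (relative_complex u v) *\<^sub>R \<Omega>"
  using assms by (simp add: relative_matrix_eq log_SO2_complex_mat norm_relative_complex)

text \<open>A real value would give equality in the Cauchy-Schwarz inequality, hence parallel
  vectors, and parallel unit vectors agree up to sign.\<close>

lemma relative_complex_notin_Reals:
  assumes "norm u = 1" "norm v = 1" "u \<noteq> v" "u \<noteq> - v"
  shows "relative_complex u v \<notin> \<real>"
proof
  assume "relative_complex u v \<in> \<real>"
  then have "\<bar>u \<bullet> v\<bar> = norm u * norm v"
    by (metis norm_relative_complex Re_complex_of_real Reals_cases complex.sel(1) norm_of_real
        relative_complex_def)
  then have "norm u *\<^sub>R v = norm v *\<^sub>R u \<or> norm u *\<^sub>R v = - norm v *\<^sub>R u"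
    by (simp only: norm_cauchy_schwarz_abs_eq)
  then show False
    using assms by auto
qed

lemma sum_list_edges:
  fixes f :: "nat \<times> nat \<Rightarrow> 'a :: comm_monoid_add"
  shows "sum_list (map f (edges n W)) =
    (\<Sum>i<n. \<Sum>j\<in>{Suc i..<n}. if W i j \<noteq> 0 then f (i, j) else 0)"
proof -
  \<comment> \<open>Both levels of the comprehension are treated over arbitrary index lists, so that
    list induction applies.\<close>
  have row: "sum_list (map f (concat (map (\<lambda>j. if W i j \<noteq> 0 then [(i, j)] else []) js))) =
      sum_list (map (\<lambda>j. if W i j \<noteq> 0 then f (i, j) else 0) js)" for i js
    by (induction js) auto
  have "sum_list (map f (concat (map (\<lambda>i. concat (map (\<lambda>j. if W i j \<noteq> 0 then [(i, j)] else [])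
        [Suc i..<n])) is))) =
      sum_list (map (\<lambda>i. \<Sum>j\<in>{Suc i..<n}. if W i j \<noteq> 0 then f (i, j) else 0) is)" for "is"
    by (induction "is") (simp_all add: row interv_sum_list_conv_sum_set_nat)
  then show ?thesis
    by (simp add: edges_def interv_sum_list_conv_sum_set_nat atLeast0LessThan)
qed

text \<open>Column \<open>k\<close> of the matrix and entry \<open>k\<close> of the vector come from
  the same edge, so the product of a row with the vector is a sum over the edge list.\<close>

lemma incidence_matrix_mult_nth:
  assumes "i < n"
  shows "vec_index (incidence_matrix n W *\<^sub>v inverse_angle_vec n W \<alpha>) i =
    (\<Sum>a<n. \<Sum>b\<in>{Suc a..<n}. (of_bool (a = i) - of_bool (b = i)) * (W a b / \<alpha> a b))"
proof -
  let ?f = "\<lambda>(a, b). (of_bool (a = i) - of_bool (b = i)) * (W a b / \<alpha> a b)"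
  have bound: "a < n \<and> b < n" if "(a, b) \<in> set (edges n W)" for a b
    using that by (auto simp: edges_def)
  have "vec_index (incidence_matrix n W *\<^sub>v inverse_angle_vec n W \<alpha>) i =
      (\<Sum>k<length (edges n W). ?f (edges n W ! k))"
    using assms
    by (auto simp: incidence_matrix_def inverse_angle_vec_def scalar_prod_def mat_of_cols_def
        vec_of_list_index atLeast0LessThan split: prod.splits dest!: nth_mem bound intro!: sum.cong)
  also have "\<dots> = sum_list (map ?f (edges n W))"
    by (simp add: sum_list_sum_nth atLeast0LessThan)
  finally show ?thesis
    by (simp add: sum_list_edges cong: if_cong) (auto intro!: sum.cong)
qed

text \<open>Pairs (i, b) with b > i contribute \<open>g i b\<close>; pairs (a, i) with a < i
  contribute \<open>- g a i\<close>, which antisymmetry turns into \<open>g i a\<close>. Together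
  they run through all indices other than \<open>i\<close>.\<close>

lemma sum_antisymmetric_edges:
  fixes g :: "nat \<Rightarrow> nat \<Rightarrow> 'a :: ring_1"
  assumes "i < n" and antisym: "\<And>j. j < n \<Longrightarrow> g j i = - g i j" and diag: "g i i = 0"
  shows "(\<Sum>a<n. \<Sum>b\<in>{Suc a..<n}. (of_bool (a = i) - of_bool (b = i)) * g a b) =
    (\<Sum>j<n. g i j)"
proof -
  have row: "(\<Sum>b\<in>{Suc a..<n}. (of_bool (a = i) - of_bool (b = i)) * g a b) =
      (if a = i then \<Sum>b\<in>{Suc i..<n}. g i b else 0) + (if a < i then g i a else 0)"
    if "a < n" for a
  proof -
    have "(\<Sum>b\<in>{Suc a..<n}. of_bool (b = i) * g a b) =
        (\<Sum>b\<in>{Suc a..<n}. if b = i then g a i else 0)"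
      by (rule sum.cong) auto
    also have "\<dots> = (if a < i then g a i else 0)"
      using \<open>i < n\<close> by simp
    finally show ?thesis
      using antisym[OF that] by (auto simp: left_diff_distrib sum_subtractf)
  qed
  have "(\<Sum>a<n. \<Sum>b\<in>{Suc a..<n}. (of_bool (a = i) - of_bool (b = i)) * g a b) =
      (\<Sum>b\<in>{Suc i..<n}. g i b) + (\<Sum>a<n. if a < i then g i a else 0)"
    using \<open>i < n\<close> by (simp add: row sum.distrib)
  also have "(\<Sum>a<n. if a < i then g i a else 0) = (\<Sum>a<i. g i a)"
    using \<open>i < n\<close> by (intro sum.mono_neutral_cong_right) auto
  also have "(\<Sum>b\<in>{Suc i..<n}. g i b) + (\<Sum>a<i. g i a) = sum (g i) ({Suc i..<n} \<union> {..<i})"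
    by (rule sum.union_disjoint[symmetric]) auto
  also have "\<dots> = sum (g i) ({..<n} - {i})"
    using \<open>i < n\<close> by (intro arg_cong[where f = "sum (g i)"]) auto
  also have "\<dots> = (\<Sum>j<n. g i j)"
    using diag by (intro sum.mono_neutral_left) auto
  finally show ?thesis .
qed

theorem proposition1:
  fixes n :: nat
    and W :: "nat \<Rightarrow> nat \<Rightarrow> real"
    and x :: "nat \<Rightarrow> real^2"
    and \<alpha> :: "nat \<Rightarrow> nat \<Rightarrow> real"
  assumes W_sym: "\<And>i j. i < n \<Longrightarrow> j < n \<Longrightarrow> i \<noteq> j \<Longrightarrow> W i j = W j i"
    and W_nonneg: "\<And>i j. i < n \<Longrightarrow> j < n \<Longrightarrow> i \<noteq> j \<Longrightarrow> W i j \<ge> 0"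
    and W_diag: "\<And>i. i < n \<Longrightarrow> W i i = 0"
    and x_unit: "\<And>i. i < n \<Longrightarrow> norm (x i) = 1"
    and x_neq: "\<And>i j. i < n \<Longrightarrow> j < n \<Longrightarrow> W i j \<noteq> 0 \<Longrightarrow> x i \<noteq> x j \<and> x i \<noteq> - x j"
    and angle: "\<And>i j. i < n \<Longrightarrow> j < n \<Longrightarrow> W i j \<noteq> 0 \<Longrightarrow>
      \<alpha> i j *\<^sub>R \<Omega> = log_SO2 (relative_matrix (x i) (x j))"
  shows "equilibrium n (vector_field n W) x \<longleftrightarrow>
    inverse_angle_vec n W \<alpha> \<in> mat_kernel (incidence_matrix n W)"
proof -
  let ?g = "\<lambda>i j. W i j / \<alpha> i j"
  let ?E = "incidence_matrix n W" and ?v = "inverse_angle_vec n W \<alpha>"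
  have \<alpha>_eq: "\<alpha> i j = Arg (relative_complex (x i) (x j))"
    if "i < n" "j < n" "W i j \<noteq> 0" for i j
    using angle[OF that] that x_unit
    by (simp add: log_SO2_relative_matrix scaleR_Omega complex_mat_inject)
  \<comment> \<open>Leaving the real axis excludes two angles: 0, which has no reciprocal, and pi,
    which conjugation does not negate under \<open>Arg\<close>.\<close>
  have nonreal: "relative_complex (x i) (x j) \<notin> \<real>" if "i < n" "j < n" "W i j \<noteq> 0" for i j
    using that x_unit x_neq[OF that] by (intro relative_complex_notin_Reals) auto
  have \<alpha>_nonzero: "\<alpha> i j \<noteq> 0" if "i < n" "j < n" "W i j \<noteq> 0" for i j
    using nonreal[OF that] Arg_eq_0 by (auto simp: \<alpha>_eq[OF that])
  \<comment> \<open>Off the edges \<alpha> is arbitrary, but the zero weight makes both quotients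
    vanish. On an edge, swapping the endpoints conjugates \<open>relative_complex\<close> and so
    negates its argument.\<close>
  have antisym: "?g j i = - ?g i j" if "i < n" "j < n" for i j
  proof (cases "W i j = 0")
    case True
    then show ?thesis
      using W_sym[OF that] by auto
  next
    case False
    have "W j i = W i j"
      using W_sym[OF that] by (cases "i = j") auto
    moreover have "\<alpha> j i = - \<alpha> i j"
      using False \<open>W j i = W i j\<close> that nonreal[OF that False]
      by (simp add: \<alpha>_eq relative_complex_commute[of "x j"] Arg_cnj)
    ultimately show ?thesis
      by simp
  qed
  \<comment> \<open>On the unit circle the radial term and all normalising factors disappear; only
    the tangent direction \<open>\<Omega> *v x i\<close> is left.\<close>
  have field: "vector_field n W x i = (- (\<Sum>j<n. ?g i j)) *\<^sub>R (\<Omega> *v x i)" if "i < n" for i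
  proof -
    have "vector_field n W x i = (\<Sum>j\<in>{j. j < n \<and> W i j \<noteq> 0}. (- ?g i j) *\<^sub>R (\<Omega> *v x i))"
      unfolding vector_field_def
      using that x_unit \<alpha>_nonzero
      by (auto simp: matrix_inv_scaleR_Omega scaleR_matrix_vector_assoc simp flip: angle intro!: sum.cong)
    also have "\<dots> = (\<Sum>j<n. (- ?g i j) *\<^sub>R (\<Omega> *v x i))"
      by (rule sum.mono_neutral_left) auto
    finally show ?thesis
      by (simp add: scaleR_sum_left sum_negf)
  qed
  have dim_E: "dim_row ?E = n"
    by (simp add: incidence_matrix_def)
  have E_nth: "vec_index (?E *\<^sub>v ?v) i = (\<Sum>j<n. ?g i j)" if "i < n" for i
    unfolding incidence_matrix_mult_nth[OF that]
    using that W_diag by (intro sum_antisymmetric_edges antisym) auto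
  \<comment> \<open>Membership in \<open>mat_kernel\<close> includes a dimension condition; both
    sizes here are the number of edges.\<close>
  have "?v \<in> carrier_vec (dim_col ?E)"
    by (rule carrier_vecI) (simp add: incidence_matrix_def inverse_angle_vec_def)
  then have "?v \<in> mat_kernel ?E \<longleftrightarrow> ?E *\<^sub>v ?v = 0\<^sub>v n"
    by (simp add: mat_kernel_def dim_E)
  moreover have "?E *\<^sub>v ?v = 0\<^sub>v n \<longleftrightarrow> (\<forall>i<n. vec_index (?E *\<^sub>v ?v) i = 0)"
    using dim_E by (auto simp del: index_mult_mat_vec)
  moreover have "equilibrium n (vector_field n W) x \<longleftrightarrow> (\<forall>i<n. vec_index (?E *\<^sub>v ?v) i = 0)"
  proof -
    \<comment> \<open>Then \<open>\<Omega> *v x i\<close> is nonzero as well, so the field vanishes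
      at \<open>i\<close> exactly when its scalar coefficient does.\<close>
    have "x i \<noteq> 0" if "i < n" for i
      using x_unit[OF that] by auto
    then show ?thesis
      by (auto simp: equilibrium_def field Omega_mult_eq_0_iff E_nth simp del: index_mult_mat_vec)
  qed
  ultimately show ?thesis
    by simp
qed

end
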